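(* Let $H\in C^{0}(\mathbb{R}^4)$ satisfy the coercivity condition (C) and the unimodality condition (U), and let $E\in\mathbb{R}$. Then the fibrewise least-energy function $\mathcal{E}\colon\mathbb{R}^2\to\mathbb{R}$ is continuous and, for every $b\in\mathbb{R}^2$, $$\#\pi_E^{-1}(b)=\begin{cases}2,&\mathcal{E}(b)<E,\\ 1,&\mathcal{E}(b)=E,\\ 0,&\mathcal{E}(b)>E.\end{cases}$$ Consequently $A_E=\{b:\mathcal{E}(b)\le E\}$ and $D_E=\{b:\mathcal{E}(b)=E\}$.
   Context: Coordinates on $\mathbb{R}^4$ are $(q_1,q_2,p_1,p_2)$. Let $C=\{q_1=0\}$, with coordinates $(q_2,p_1,p_2)$, and $\pi\colon C\to\mathbb{R}^2$, $\pi(0,q_2,p_1,p_2)=b=(q_2,p_2)$. The fibre function is $h_b(p_1)=H(0,q_2,p_1,p_2)$. Put $\Sigma_E^{\mathrm{sec}}=\{(q_2,p_1,p_2): h_{b}(p_1)=E\}$, $\pi_E=\pi|_{\Sigma_E^{\mathrm{sec}}}$, admissible region $A_E=\pi_E(\Sigma_E^{\mathrm{sec}})$, least-energy function $\mathcal{E}(b)=\inf_{p_1\in\mathbb{R}}h_b(p_1)$, critical locus $\mathrm{Crit}(\pi_E)=\{x\in\Sigma_E^{\mathrm{sec}}:\partial_{p_1}H(x)=0\}$ (where $\partial_{p_1}H(0,q_2,p_1,p_2)=h_b'(p_1)$, which exists by (U)), and discriminant $D_E=\pi_E(\mathrm{Crit}(\pi_E))$. Condition (C): $h_b(p_1)\to+\infty$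 as $|p_1|\to\infty$, locally uniformly in $b$; that is, every $b_0\in\mathbb{R}^2$ has a neighbourhood $N$ such that for every $M$ there is $R$ with $h_b(p_1)>M$ for all $b\in N$ and $|p_1|>R$. Condition (U): for every $b$, $h_b\in C^1(\mathbb{R})$ and there is a unique $m(b)\in\mathbb{R}$ with $h_b'<0$ on $(-\infty,m(b))$ and $h_b'>0$ on $(m(b),\infty)$. *)

theory Defs
  imports "HOL-Analysis.Analysis"
begin

text \<open>
  The components of \<open>x :: real ^ 4\<close> are \<open>x $ 1 = q\<^sub>1\<close>, \<open>x $ 2 = q\<^sub>2\<close>, \<open>x $ 3 = p\<^sub>1\<close>, \<open>x $ 4 = p\<^sub>2\<close>;
  those of a base point \<open>b :: real ^ 2\<close> are \<open>b $ 1 = q\<^sub>2\<close>, \<open>b $ 2 = p\<^sub>2\<close>.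
  The hyperplane \<open>q\<^sub>1 = 0\<close> is kept as a subset of \<open>real ^ 4\<close>; its coordinates \<open>(q\<^sub>2, p\<^sub>1, p\<^sub>2)\<close>
  are the last three components.
\<close>

definition section_C :: "(real ^ 4) set" where
  "section_C = {x. x $ 1 = 0}"

definition proj :: "real ^ 4 \<Rightarrow> real ^ 2" where
  "proj x = vector [x $ 2, x $ 4]"

definition fibre_fun :: "(real ^ 4 \<Rightarrow> real) \<Rightarrow> real ^ 2 \<Rightarrow> real \<Rightarrow> real" where
  "fibre_fun H b p = H (vector [0, b $ 1, p, b $ 2])"

definition Sigma_sec :: "(real ^ 4 \<Rightarrow> real) \<Rightarrow> real \<Rightarrow> (real ^ 4) set" where
  "Sigma_sec H E = {x \<in> section_C. fibre_fun H (proj x) (x $ 3) = E}"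

definition fibre_E :: "(real ^ 4 \<Rightarrow> real) \<Rightarrow> real \<Rightarrow> real ^ 2 \<Rightarrow> (real ^ 4) set" where
  "fibre_E H E b = {x \<in> Sigma_sec H E. proj x = b}"

definition admissible :: "(real ^ 4 \<Rightarrow> real) \<Rightarrow> real \<Rightarrow> (real ^ 2) set" where
  "admissible H E = proj ` Sigma_sec H E"

text \<open>
  The infimum is taken in \<open>real\<close>, so it has its usual meaning only when \<open>fibre_fun H b\<close> is bounded
  below.
\<close>

definition least_energy :: "(real ^ 4 \<Rightarrow> real) \<Rightarrow> real ^ 2 \<Rightarrow> real" where
  "least_energy H b = (INF p. fibre_fun H b p)"

definition partial_p1 :: "(real ^ 4 \<Rightarrow> real) \<Rightarrow> real ^ 4 \<Rightarrow> real" where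
  "partial_p1 H x = deriv (\<lambda>p. H (vector [x $ 1, x $ 2, p, x $ 4])) (x $ 3)"

definition Crit :: "(real ^ 4 \<Rightarrow> real) \<Rightarrow> real \<Rightarrow> (real ^ 4) set" where
  "Crit H E = {x \<in> Sigma_sec H E. partial_p1 H x = 0}"

definition discriminant :: "(real ^ 4 \<Rightarrow> real) \<Rightarrow> real \<Rightarrow> (real ^ 2) set" where
  "discriminant H E = proj ` Crit H E"

definition coercive_C :: "(real ^ 4 \<Rightarrow> real) \<Rightarrow> bool" where
  "coercive_C H \<longleftrightarrow>
     (\<forall>b0. \<exists>N. open N \<and> b0 \<in> N \<and>
        (\<forall>M. \<exists>R. \<forall>b\<in>N. \<forall>p. \<bar>p\<bar> > R \<longrightarrow> fibre_fun H b p > M))"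

definition unimodal_U :: "(real ^ 4 \<Rightarrow> real) \<Rightarrow> bool" where
  "unimodal_U H \<longleftrightarrow>
     (\<forall>b. fibre_fun H b C1_differentiable_on UNIV \<and>
        (\<exists>!m. (\<forall>p<m. deriv (fibre_fun H b) p < 0) \<and>
              (\<forall>p>m. deriv (fibre_fun H b) p > 0)))"

end

theory Submission
  imports Defs
begin

text \<open>
  On each fibre, unimodality makes \<open>h\<^sub>b\<close> strictly decreasing up to \<open>m(b)\<close> and strictly increasing
  afterwards, so \<open>m(b)\<close> is the only minimiser and the only critical point, and every level above
  the minimum is hit exactly once on each side, by coercivity and the intermediate value theorem.
  The infimum over the fibre is upper semicontinuous in \<open>b\<close>, as an infimum of continuous functions;
  it is lower semicontinuous because coercivity confines the relevant momenta to a compact interval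
  locally uniformly in \<open>b\<close>, where the tube lemma applies.
\<close>

lemma vector_4 [simp]:
  "(vector [w, x, y, z] :: ('a::zero) ^ 4) $ 1 = w"
  "(vector [w, x, y, z] :: ('a::zero) ^ 4) $ 2 = x"
  "(vector [w, x, y, z] :: ('a::zero) ^ 4) $ 3 = y"
  "(vector [w, x, y, z] :: ('a::zero) ^ 4) $ 4 = z"
  unfolding vector_def by simp_all

lemma vec_4_eq_iff:
  fixes u v :: "'a ^ 4"
  shows "u = v \<longleftrightarrow> u $ 1 = v $ 1 \<and> u $ 2 = v $ 2 \<and> u $ 3 = v $ 3 \<and> u $ 4 = v $ 4"
  by (simp add: vec_eq_iff forall_4)

lemma continuous_on_vector_4:
  fixes f g h k :: "'a::topological_space \<Rightarrow> 'b::{zero, topological_space}"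
  assumes "continuous_on S f" "continuous_on S g" "continuous_on S h" "continuous_on S k"
  shows "continuous_on S (\<lambda>x. vector [f x, g x, h x, k x] :: 'b ^ 4)"
proof -
  have "continuous_on S (\<lambda>x. (vector [f x, g x, h x, k x] :: 'b ^ 4) $ i)" for i
    using exhaust_4[of i] assms by auto
  then have "continuous_on S (\<lambda>x. \<chi> i. (vector [f x, g x, h x, k x] :: 'b ^ 4) $ i)"
    by (rule continuous_on_vec_lambda)
  then show ?thesis
    by simp
qed

subsection \<open>The infimum of a locally uniformly coercive family\<close>

text \<open>On \<open>{-R..R}\<close> compactness bounds the values from below; outside it
  \<open>M\<close> does.\<close>

lemma bdd_below_range_coercive:
  fixes f :: "real \<Rightarrow> real"
  assumes cont: "continuous_on UNIV f"
    and coercive: "\<And>p. \<bar>p\<bar> > R \<Longrightarrow> f p > M"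
  shows "bdd_below (range f)"
proof -
  have "compact (f ` {-R..R})"
    using cont by (intro compact_continuous_image) (auto intro: continuous_on_subset)
  then have "bdd_below (f ` {-R..R} \<union> {M<..})"
    by (simp add: bounded_imp_bdd_below compact_imp_bounded)
  moreover have "range f \<subseteq> f ` {-R..R} \<union> {M<..}"
    using coercive by (force simp: abs_le_iff not_less)
  ultimately show ?thesis
    by (rule bdd_below_mono)
qed

lemma continuous_on_INF_coercive:
  fixes f :: "'a::topological_space \<Rightarrow> real \<Rightarrow> real"
  assumes cont: "continuous_on UNIV (\<lambda>(b, p). f b p)"
    and coercive: "\<And>b0. \<exists>N. open N \<and> b0 \<in> N \<and> (\<forall>M. \<exists>R. \<forall>b\<in>N. \<forall>p. \<bar>p\<bar> > R \<longrightarrow> f b p > M)"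
  shows "\<And>b. bdd_below (range (f b))"
    and "continuous_on UNIV (\<lambda>b. INF p. f b p)"
proof -
  have cont_fibre: "continuous_on UNIV (f b)" for b
    using continuous_on_compose2[OF cont, of UNIV "\<lambda>p. (b, p)"] by (simp add: continuous_intros)
  have cont_base: "continuous_on UNIV (\<lambda>b. f b p)" for p
    using continuous_on_compose2[OF cont, of UNIV "\<lambda>b. (b, p)"] by (simp add: continuous_intros)
  show bdd: "bdd_below (range (f b))" for b
  proof -
    obtain R where "\<And>p. \<bar>p\<bar> > R \<Longrightarrow> f b p > 0"
      using coercive[of b] by metis
    with cont_fibre show ?thesis
      by (rule bdd_below_range_coercive)
  qed
  have "((\<lambda>b. INF p. f b p) \<longlongrightarrow> (INF p. f b0 p)) (at b0)" for b0
  proof (rule order_tendstoI)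
    \<comment> \<open>Upper half: a single \<open>p\<close> with value below \<open>a\<close> at
      \<open>b0\<close> keeps such a value at nearby \<open>b\<close> and bounds the infimum
      there.\<close>
    fix a assume "(INF p. f b0 p) < a"
    then obtain p where "f b0 p < a"
      by (auto simp: cINF_less_iff bdd)
    moreover have "((\<lambda>b. f b p) \<longlongrightarrow> f b0 p) (at b0)"
      using cont_base[of p] by (simp add: continuous_on_def)
    ultimately have "\<forall>\<^sub>F b in at b0. f b p < a"
      by (simp add: order_tendstoD)
    then show "\<forall>\<^sub>F b in at b0. (INF p. f b p) < a"
      by eventually_elim (auto simp: cINF_less_iff bdd)
  next
    fix a assume "a < (INF p. f b0 p)"
    \<comment> \<open>Lower half: a pointwise bound by \<open>c\<close> reaches the infimum only as
      a non-strict inequality; the gap between \<open>a\<close> and \<open>c\<close> restores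
      strictness.\<close>
    then obtain c where c: "a < c" "c < (INF p. f b0 p)"
      using dense by blast
    obtain N R where N: "open N" "b0 \<in> N"
      and R: "\<And>b p. b \<in> N \<Longrightarrow> \<bar>p\<bar> > R \<Longrightarrow> f b p > c"
      using coercive[of b0] by metis
    have "c < f b0 p" for p
      using c(2) cINF_lower[OF bdd, of p b0] by simp
    then have "{b0} \<times> {-R..R} \<subseteq> {(b, p). c < f b p}"
      by auto
    moreover have "open {(b, p). c < f b p}"
      using open_Collect_less[OF continuous_on_const cont, of c] by (simp add: case_prod_beta')
    \<comment> \<open>The open set contains the compact slice over \<open>b0\<close>, hence a whole
      tube around it.\<close>
    ultimately obtain V where V: "b0 \<in> V" "open V" "V \<times> {-R..R} \<subseteq> {(b, p). c < f b p}"
      using Elementary_Topology.tube_lemma[of "{-R..R}" "{(b, p). c < f b p}" b0] by auto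
    \<comment> \<open>Coercivity over \<open>N\<close> handles the momenta beyond \<open>R\<close>,
      the tube over \<open>V\<close> all others.\<close>
    have "a < (INF p. f b p)" if "b \<in> N \<inter> V" for b
    proof -
      have "c \<le> f b p" for p
      proof (cases "\<bar>p\<bar> > R")
        case True
        with R[of b p] that show ?thesis
          by simp
      next
        case False
        then have "(b, p) \<in> V \<times> {-R..R}"
          using that by auto
        with V(3) have "(b, p) \<in> {(b, p). c < f b p}"
          by (rule subsetD)
        then show ?thesis
          by simp
      qed
      then have "c \<le> (INF p. f b p)"
        by (intro cINF_greatest) auto
      with c(1) show ?thesis
        by simp
    qed
    moreover have "\<forall>\<^sub>F b in at b0. b \<in> N \<inter> V"
      using N V by (intro eventually_at_in_open') auto
    ultimately show "\<forall>\<^sub>F b in at b0. a < (INF p. f b p)"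
      by (rule eventually_mono[rotated])
  qed
  then show "continuous_on UNIV (\<lambda>b. INF p. f b p)"
    by (simp add: continuous_on_def)
qed

subsection \<open>Unimodal functions on the line\<close>

text \<open>The turning point is a parameter, so that each fibre can be interpreted with its own
  \<open>m\<close>. The sign conditions leave out \<open>m\<close> itself; that the derivative
  vanishes there is derived below.\<close>

locale unimodal =
  fixes f :: "real \<Rightarrow> real" and m :: real
  assumes differentiable: "f differentiable (at x)"
    and deriv_neg: "p < m \<Longrightarrow> deriv f p < 0"
    and deriv_pos: "p > m \<Longrightarrow> deriv f p > 0"
begin

lemma has_deriv: "DERIV f x :> deriv f x"
  using differentiable by (simp add: DERIV_deriv_iff_real_differentiable)

lemma continuous: "continuous_on S f"
  using has_deriv by (meson DERIV_isCont continuous_at_imp_continuous_on)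

text \<open>The mean value argument needs the sign of the derivative only on the open interval, so
  the endpoint \<open>m\<close> is allowed.\<close>

lemma decreasing: "p < q \<Longrightarrow> q \<le> m \<Longrightarrow> f q < f p"
  by (rule DERIV_neg_imp_decreasing_open) (auto intro!: exI has_deriv deriv_neg continuous)

lemma increasing: "m \<le> p \<Longrightarrow> p < q \<Longrightarrow> f p < f q"
  by (rule DERIV_pos_imp_increasing_open) (auto intro!: exI has_deriv deriv_pos continuous)

lemma minimum: "f m \<le> f p"
  using decreasing[of p m] increasing[of m p] by (cases p m rule: linorder_cases) auto

lemma minimum_unique: "f p = f m \<longleftrightarrow> p = m"
  using decreasing[of p m] increasing[of m p] by (cases p m rule: linorder_cases) auto

lemma INF_eq: "(INF p. f p) = f m"
  by (rule cInf_eq_minimum) (auto intro: minimum)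

lemma deriv_eq_0_iff: "deriv f p = 0 \<longleftrightarrow> p = m"
proof
  show "deriv f p = 0 \<Longrightarrow> p = m"
    using deriv_neg[of p] deriv_pos[of p] by (cases p m rule: linorder_cases) auto
  \<comment> \<open>Fermat's criterion; since \<open>m\<close> is a global minimiser, any radius
    works, here 1.\<close>
  show "p = m \<Longrightarrow> deriv f p = 0"
    using DERIV_local_min[OF has_deriv[of m], of 1] minimum by simp
qed

lemma level_set_above:
  assumes coercive: "\<And>p. \<bar>p\<bar> > R \<Longrightarrow> f p > c" and "f m < c"
  shows "card {p. f p = c} = 2"
proof -
  \<comment> \<open>Both \<open>r\<close> and \<open>-r\<close> lie beyond \<open>R\<close>, and
    they enclose \<open>m\<close>, so the intermediate value theorem applies on each side of
    \<open>m\<close>.\<close>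
  define r where "r = \<bar>R\<bar> + \<bar>m\<bar> + 1"
  have "f (-r) > c" "f r > c" "-r < m" "m < r"
    using coercive[of r] coercive[of "-r"] unfolding r_def by auto
  then obtain p q where p: "p \<le> m" "f p = c" and q: "m \<le> q" "f q = c"
    using IVT2'[of f m c "-r", OF _ _ _ continuous] IVT'[of f m c r, OF _ _ _ continuous] \<open>f m < c\<close>
    by (meson less_imp_le)
  have "p \<noteq> m" "q \<noteq> m"
    using p q \<open>f m < c\<close> by auto
  \<comment> \<open>Strict monotonicity on each branch rules out a second solution there.\<close>
  have "x = p \<or> x = q" if "f x = c" for x
  proof (cases "x \<le> m")
    case True
    with p that decreasing[of x p] decreasing[of p x] show ?thesis
      by (cases x p rule: linorder_cases) auto
  next
    case False
    with q that increasing[of x q] increasing[of q x] show ?thesis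
      by (cases x q rule: linorder_cases) auto
  qed
  with p q have "{p. f p = c} = {p, q}"
    by auto
  with p q \<open>p \<noteq> m\<close> \<open>q \<noteq> m\<close> show ?thesis
    by simp
qed

text \<open>Finiteness is recorded because \<open>card\<close> is 0 on infinite sets too, so a count
  of 0 alone would not show emptiness.\<close>

lemma card_level_set:
  assumes "\<And>p. \<bar>p\<bar> > R \<Longrightarrow> f p > c"
  shows "finite {p. f p = c}"
    and "card {p. f p = c} = (if f m < c then 2 else if f m = c then 1 else 0)"
proof -
  consider "f m < c" | "{p. f p = c} = {m}" "f m = c" | "{p. f p = c} = {}" "f m > c"
  proof (cases "f m" c rule: linorder_cases)
    case greater
    then have "f p \<noteq> c" for p
      using minimum[of p] by auto
    with greater that(3) show ?thesis
      by simp
  qed (use that minimum_unique in auto)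
  then have "finite {p. f p = c} \<and>
      card {p. f p = c} = (if f m < c then 2 else if f m = c then 1 else 0)"
  proof cases
    \<comment> \<open>A positive cardinality already forces finiteness.\<close>
    case 1
    with level_set_above[OF assms] show ?thesis
      by (simp add: card_ge_0_finite)
  qed auto
  then show "finite {p. f p = c}"
    and "card {p. f p = c} = (if f m < c then 2 else if f m = c then 1 else 0)"
    by auto
qed

end

subsection \<open>The section and its fibres\<close>

lemma unimodal_U_fibre:
  assumes "unimodal_U H"
  obtains m where "unimodal (fibre_fun H b) m"
proof -
  obtain m where m: "\<forall>p<m. deriv (fibre_fun H b) p < 0" "\<forall>p>m. deriv (fibre_fun H b) p > 0"
    using assms unfolding unimodal_U_def by meson
  have "fibre_fun H b C1_differentiable_on UNIV"
    using assms by (simp add: unimodal_U_def)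
  then have "fibre_fun H b differentiable (at x)" for x
    by (simp add: C1_differentiable_on_eq)
  with m have "unimodal (fibre_fun H b) m"
    by unfold_locales auto
  then show thesis
    by (rule that)
qed

lemma continuous_on_fibre_fun:
  assumes "continuous_on UNIV H"
  shows "continuous_on UNIV (\<lambda>(b, p). fibre_fun H b p)"
  unfolding fibre_fun_def case_prod_beta
  by (rule continuous_on_compose2[OF assms])
     (auto intro!: continuous_on_vector_4 continuous_intros)

lemma proj_vector [simp]: "proj (vector [w, x, y, z]) = vector [x, z]"
  by (simp add: proj_def)

lemma vector_2_nth: "vector [b $ 1, b $ 2] = (b :: real ^ 2)"
  by (simp add: vec_eq_iff forall_2)

text \<open>Reduces counting in the section to a level set in one real variable; the preimage of a
  point \<open>x\<close> is its momentum \<open>x $ 3\<close>.\<close>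

lemma fibre_E_eq:
  "fibre_E H E b = (\<lambda>p. vector [0, b $ 1, p, b $ 2]) ` {p. fibre_fun H b p = E}"
proof (intro equalityI subsetI)
  fix x assume "x \<in> fibre_E H E b"
  then show "x \<in> (\<lambda>p. vector [0, b $ 1, p, b $ 2]) ` {p. fibre_fun H b p = E}"
    by (intro image_eqI[of _ _ "x $ 3"])
       (auto simp: fibre_E_def Sigma_sec_def section_C_def vec_4_eq_iff proj_def)
qed (auto simp: fibre_E_def Sigma_sec_def section_C_def vector_2_nth)

lemma inj_fibre_embedding: "inj (\<lambda>p. vector [0, b $ 1, p, b $ 2] :: real ^ 4)"
  by (rule injI) (simp add: vec_4_eq_iff)

lemma card_fibre_E: "card (fibre_E H E b) = card {p. fibre_fun H b p = E}"
  unfolding fibre_E_eq by (rule card_image) (rule inj_on_subset[OF inj_fibre_embedding], simp)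

lemma admissible_iff: "b \<in> admissible H E \<longleftrightarrow> fibre_E H E b \<noteq> {}"
  by (auto simp: admissible_def fibre_E_def)

text \<open>As the first coordinate is 0, varying the third one traces exactly the fibre over
  \<open>proj x\<close>.\<close>

lemma partial_p1_section:
  "x \<in> section_C \<Longrightarrow> partial_p1 H x = deriv (fibre_fun H (proj x)) (x $ 3)"
  by (simp add: partial_p1_def section_C_def fibre_fun_def[abs_def] proj_def)

lemma discriminant_iff:
  "b \<in> discriminant H E \<longleftrightarrow> (\<exists>p. fibre_fun H b p = E \<and> deriv (fibre_fun H b) p = 0)"
proof -
  have "b \<in> discriminant H E \<longleftrightarrow> (\<exists>x \<in> fibre_E H E b. deriv (fibre_fun H b) (x $ 3) = 0)"
    by (auto simp: discriminant_def Crit_def fibre_E_def Sigma_sec_def partial_p1_section)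
  then show ?thesis
    by (auto simp: fibre_E_eq)
qed

text \<open>Boundedness below makes the real-valued \<open>INF\<close> a genuine infimum, and
  finiteness makes \<open>card\<close> a genuine count.\<close>

theorem proposition4p3:
  fixes H :: "real ^ 4 \<Rightarrow> real" and E :: real
  assumes "continuous_on UNIV H"
    and "coercive_C H"
    and "unimodal_U H"
  shows "(\<forall>b. bdd_below (range (fibre_fun H b))) \<and>
    continuous_on UNIV (least_energy H) \<and>
    (\<forall>b. finite (fibre_E H E b) \<and>
         card (fibre_E H E b) =
           (if least_energy H b < E then 2 else if least_energy H b = E then 1 else 0)) \<and>
    admissible H E = {b. least_energy H b \<le> E} \<and>
    discriminant H E = {b. least_energy H b = E}"
proof -
  have coercive: "\<exists>N. open N \<and> b0 \<in> N \<and>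
      (\<forall>M. \<exists>R. \<forall>b\<in>N. \<forall>p. \<bar>p\<bar> > R \<longrightarrow> fibre_fun H b p > M)" for b0
    using assms(2) by (simp add: coercive_C_def)
  note INF = continuous_on_INF_coercive[OF continuous_on_fibre_fun[OF assms(1)] coercive]
  have fibre: "finite (fibre_E H E b)" (is ?finite)
    "card (fibre_E H E b) =
      (if least_energy H b < E then 2 else if least_energy H b = E then 1 else 0)" (is ?card)
    "b \<in> discriminant H E \<longleftrightarrow> least_energy H b = E" (is ?disc) for b
  proof -
    obtain m where "unimodal (fibre_fun H b) m"
      using unimodal_U_fibre[OF assms(3)] .
    then interpret unimodal "fibre_fun H b" m .
    obtain R where R: "\<And>p. \<bar>p\<bar> > R \<Longrightarrow> fibre_fun H b p > E"
      using coercive[of b] by metis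
    have least: "least_energy H b = fibre_fun H b m"
      by (simp add: least_energy_def INF_eq)
    show ?finite
      using card_level_set(1)[OF R] by (simp add: fibre_E_eq)
    show ?card
      using card_level_set(2)[OF R] by (simp add: card_fibre_E least)
    show ?disc
      by (simp add: discriminant_iff deriv_eq_0_iff least)
  qed
  have "b \<in> admissible H E \<longleftrightarrow> least_energy H b \<le> E" for b
  proof -
    \<comment> \<open>For a finite fibre, nonzero cardinality means nonempty; the counts 2 and 1
      together cover \<open>least_energy H b \<le> E\<close>.\<close>
    have "b \<in> admissible H E \<longleftrightarrow> card (fibre_E H E b) \<noteq> 0"
      using fibre(1)[of b] by (simp add: admissible_iff)
    then show ?thesis
      unfolding fibre(2) by auto
  qed
  with INF fibre show ?thesis
    by (auto simp: least_energy_def[abs_def])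
qed

end
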